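(* Let $k,m\ge1$ be integers. (i) The spectrum of the integrated signless Laplacian matrix of $K^M_{k(m)}$ is $(4mk-4m)^{(1)}$, $(2mk-4m)^{(k-1)}$, $(2mk-2m)^{(2mk-k)}$. (ii) The spectrum of the integrated signless Laplacian matrix of $K^D_{k(m)}$ is $(2mk-2m)^{(1)}$, $0^{(1)}$, $(mk)^{(k-1)}$, $(mk-2m)^{(k-1)}$, $(mk-m)^{(2km-2k)}$. Here $\lambda^{(t)}$ denotes an eigenvalue of multiplicity $t$.
   Context: A mixed graph has a finite vertex set, a multiset of edges (unordered pairs) and a multiset of arcs (ordered pairs). $K^M_{k(m)}$ is the mixed graph whose vertex set is partitioned into $k$ parts of size $m$, in which for every two vertices $u,v$ in different parts there is exactly one edge $\{u,v\}$, exactly one arc $(u,v)$ and exactly one arc $(v,u)$, and no other edges or arcs. $K^D_{k(m)}$ is the same but with no edges. $d(v)$ is the number of edges at $v$; $d^+(v)$ (resp. $d^-(v)$) the number of arcs starting (resp. ending) at $v$. For $V_G=\{v_1,\dots,v_n\}$, the integrated adjacency matrix $\mathcal{I}(G)$ is the $2n\times 2n$ matrix indexed by $v'_1,\dots,v'_n,v''_1,\dots,v''_n$ whose $(v'_i,v'_j)$ and $(v''_i,v''_j)$ entries are the number of edges joining $v_i,v_j$ and whose $(v'_i,v''_j)$ and $(v''_j,v'_i)$ entries are the number of arcs from $v_i$ to $v_j$. The integrated degree matrix $\mathcal{I}^D(G)$ is diagonal with $(v'_i,v'_i)$ entry $d(v_i)+d^+(v_i)$ and $(v''_i,v''_i)$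 entry $d(v_i)+d^-(v_i)$; the integrated signless Laplacian matrix is $\mathcal{I}^Q(G)=\mathcal{I}^D(G)+\mathcal{I}(G)$. *)

theory Defs
  imports
    "Jordan_Normal_Form.Char_Poly"
    "HOL-Library.Uprod"
    "HOL-Library.Disjoint_Sets"
begin

record 'a mixed_graph =
  verts :: "'a set"
  edges :: "'a uprod multiset"
  arcs :: "('a \<times> 'a) multiset"

definition mixed_graph :: "'a mixed_graph \<Rightarrow> bool" where
  "mixed_graph G \<longleftrightarrow> finite (verts G) \<and>
     (\<forall>e \<in># edges G. set_uprod e \<subseteq> verts G) \<and>
     (\<forall>a \<in># arcs G. fst a \<in> verts G \<and> snd a \<in> verts G)"

text \<open>A loop (an edge \<open>Upair v v\<close>) counts once in \<open>deg\<close>; the complete multipartite graphs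
  below have no loops.\<close>

definition deg :: "'a mixed_graph \<Rightarrow> 'a \<Rightarrow> nat" where
  "deg G v = size {# e \<in># edges G. v \<in> set_uprod e #}"

definition out_deg :: "'a mixed_graph \<Rightarrow> 'a \<Rightarrow> nat" where
  "out_deg G v = size {# a \<in># arcs G. fst a = v #}"

definition in_deg :: "'a mixed_graph \<Rightarrow> 'a \<Rightarrow> nat" where
  "in_deg G v = size {# a \<in># arcs G. snd a = v #}"

text \<open>The matrices depend on an ordering \<open>v\<^sub>1, \<dots>, v\<^sub>n\<close> of the vertices, given as a list.
  With \<open>n = length vs\<close>, the indices \<open>i\<close> and \<open>n + i\<close> (for \<open>i < n\<close>) stand for
  the two copies \<open>v'\<close> and \<open>v''\<close> of the vertex \<open>v = vs ! i\<close>.\<close>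

definition vertex_ordering :: "'a mixed_graph \<Rightarrow> 'a list \<Rightarrow> bool" where
  "vertex_ordering G vs \<longleftrightarrow> distinct vs \<and> set vs = verts G"

definition edge_matrix :: "'a mixed_graph \<Rightarrow> 'a list \<Rightarrow> 'b::semiring_1 mat" where
  "edge_matrix G vs = mat (length vs) (length vs)
     (\<lambda>(i, j). of_nat (count (edges G) (Upair (vs ! i) (vs ! j))))"

definition arc_matrix :: "'a mixed_graph \<Rightarrow> 'a list \<Rightarrow> 'b::semiring_1 mat" where
  "arc_matrix G vs = mat (length vs) (length vs)
     (\<lambda>(i, j). of_nat (count (arcs G) (vs ! i, vs ! j)))"

definition integrated_adjacency :: "'a mixed_graph \<Rightarrow> 'a list \<Rightarrow> 'b::semiring_1 mat" where
  "integrated_adjacency G vs =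
     four_block_mat (edge_matrix G vs) (arc_matrix G vs)
                    (transpose_mat (arc_matrix G vs)) (edge_matrix G vs)"

definition integrated_degree :: "'a mixed_graph \<Rightarrow> 'a list \<Rightarrow> 'b::semiring_1 mat" where
  "integrated_degree G vs = mat_diag (2 * length vs)
     (\<lambda>i. if i < length vs
          then of_nat (deg G (vs ! i) + out_deg G (vs ! i))
          else of_nat (deg G (vs ! (i - length vs)) + in_deg G (vs ! (i - length vs))))"

definition integrated_signless_laplacian ::
    "'a mixed_graph \<Rightarrow> 'a list \<Rightarrow> 'b::semiring_1 mat" where
  "integrated_signless_laplacian G vs = integrated_degree G vs + integrated_adjacency G vs"

text \<open>Eigenvalues with algebraic multiplicity. Taken over the complex numbers, so that no
  eigenvalue is lost.\<close>

definition spectrum_mset :: "complex mat \<Rightarrow> complex multiset" where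
  "spectrum_mset A = proots (char_poly A)"

definition equipartition :: "nat \<Rightarrow> nat \<Rightarrow> 'a set \<Rightarrow> 'a set set \<Rightarrow> bool" where
  "equipartition k m V P \<longleftrightarrow> partition_on V P \<and> card P = k \<and> (\<forall>X \<in> P. card X = m)"

definition same_part :: "'a set set \<Rightarrow> 'a \<Rightarrow> 'a \<Rightarrow> bool" where
  "same_part P u v \<longleftrightarrow> (\<exists>X \<in> P. u \<in> X \<and> v \<in> X)"

text \<open>\<open>is_KM k m G\<close> and \<open>is_KD k m G\<close> say that \<open>G\<close> is (a copy, on an arbitrary vertex set,
  of) the graph $K^M_{k(m)}$, respectively $K^D_{k(m)}$.\<close>

definition is_KM :: "nat \<Rightarrow> nat \<Rightarrow> 'a mixed_graph \<Rightarrow> bool" where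
  "is_KM k m G \<longleftrightarrow> mixed_graph G \<and>
     (\<exists>P. equipartition k m (verts G) P \<and>
        (\<forall>u \<in> verts G. \<forall>v \<in> verts G.
           count (edges G) (Upair u v) = (if same_part P u v then 0 else 1) \<and>
           count (arcs G) (u, v) = (if same_part P u v then 0 else 1)))"

definition is_KD :: "nat \<Rightarrow> nat \<Rightarrow> 'a mixed_graph \<Rightarrow> bool" where
  "is_KD k m G \<longleftrightarrow> mixed_graph G \<and> edges G = {#} \<and>
     (\<exists>P. equipartition k m (verts G) P \<and>
        (\<forall>u \<in> verts G. \<forall>v \<in> verts G.
           count (arcs G) (u, v) = (if same_part P u v then 0 else 1)))"

text \<open>Both graphs exist, for all \<open>k\<close> and all \<open>m \<ge> 1\<close>.\<close>

lemma equipartition_grid: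
  assumes "m \<ge> 1"
  shows "equipartition k m ({..<k} \<times> {..<m}) ((\<lambda>i. {i} \<times> {..<m}) ` {..<k})"
proof -
  have 0: "0 \<in> {..<m}"
    using assms by simp
  have "inj_on (\<lambda>i. {i} \<times> {..<m}) {..<k}"
    using 0 by (intro inj_onI) blast
  moreover have "partition_on ({..<k} \<times> {..<m}) ((\<lambda>i. {i} \<times> {..<m}) ` {..<k})"
    using 0 by (intro partition_onI) (auto simp: disjnt_def)
  ultimately show ?thesis
    by (auto simp: equipartition_def card_image card_cartesian_product)
qed

lemma same_part_grid:
  assumes "u \<in> {..<k} \<times> {..<m}" "v \<in> {..<k} \<times> {..<m}"
  shows "same_part ((\<lambda>i. {i} \<times> {..<m}) ` {..<k}) u v \<longleftrightarrow> fst u = fst v"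
  using assms by (auto simp: same_part_def)

lemma KM_KD_exist:
  fixes k m :: nat
  assumes "m \<ge> 1"
  shows "\<exists>G :: (nat \<times> nat) mixed_graph. is_KM k m G"
    and "\<exists>G :: (nat \<times> nat) mixed_graph. is_KD k m G"
proof -
  define V where "V = {..<k} \<times> {..<m}"
  define P where "P = (\<lambda>i. {i} \<times> {..<m}) ` {..<k}"
  define A where "A = {(u, v). u \<in> V \<and> v \<in> V \<and> fst u \<noteq> fst v}"
  define E where "E = case_prod Upair ` A"
  have finV: "finite V" unfolding V_def by simp
  have finA: "finite A"
    by (rule finite_subset[of _ "V \<times> V"]) (auto simp: A_def finV)
  have finE: "finite E" unfolding E_def using finA by simp
  have eq: "equipartition k m V P"
    unfolding V_def P_def by (rule equipartition_grid[OF assms])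
  have sp: "same_part P u v \<longleftrightarrow> fst u = fst v" if "u \<in> V" "v \<in> V" for u v
    using same_part_grid[of u k m v] that unfolding V_def P_def by simp
  have inA: "(u, v) \<in> A \<longleftrightarrow> \<not> same_part P u v" if "u \<in> V" "v \<in> V" for u v
    using that sp unfolding A_def by auto
  have symA: "(v, u) \<in> A \<longleftrightarrow> (u, v) \<in> A" for u v
    unfolding A_def by auto
  have E_iff: "Upair u v \<in> E \<longleftrightarrow> (u, v) \<in> A" for u v
  proof
    assume "Upair u v \<in> E"
    then obtain x y where "(x, y) \<in> A" "Upair u v = Upair x y"
      unfolding E_def by auto
    then show "(u, v) \<in> A"
      using symA by (metis Upair_inject)
  next
    assume "(u, v) \<in> A"
    then show "Upair u v \<in> E"
      unfolding E_def by (metis case_prod_conv image_eqI)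
  qed
  have inE: "Upair u v \<in> E \<longleftrightarrow> \<not> same_part P u v" if "u \<in> V" "v \<in> V" for u v
    using E_iff inA[OF that] by simp
  have cA: "count (mset_set A) (u, v) = (if same_part P u v then 0 else 1)"
    if "u \<in> V" "v \<in> V" for u v
    using inA[OF that] finA by (simp add: count_mset_set')
  have cE: "count (mset_set E) (Upair u v) = (if same_part P u v then 0 else 1)"
    if "u \<in> V" "v \<in> V" for u v
    using inE[OF that] finE by (simp add: count_mset_set')
  have "mixed_graph \<lparr>verts = V, edges = mset_set E, arcs = mset_set A\<rparr>"
    using finV finE finA by (auto simp: mixed_graph_def E_def A_def)
  then have "is_KM k m \<lparr>verts = V, edges = mset_set E, arcs = mset_set A\<rparr>"
    unfolding is_KM_def using eq cA cE by auto
  then show "\<exists>G :: (nat \<times> nat) mixed_graph. is_KM k m G" ..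
  have "mixed_graph \<lparr>verts = V, edges = {#}, arcs = mset_set A\<rparr>"
    using finV finA by (auto simp: mixed_graph_def A_def)
  then have "is_KD k m \<lparr>verts = V, edges = {#}, arcs = mset_set A\<rparr>"
    unfolding is_KD_def using eq cA by auto
  then show "\<exists>G :: (nat \<times> nat) mixed_graph. is_KD k m G" ..
qed

end

theory Submission
  imports Defs
begin

text \<open>With \<open>N\<close> the adjacency matrix of the complete multipartite graph, both
  integrated signless Laplacians have the form
  \<open>[[a I + b N, N], [N, a I + b N]]\<close> with \<open>b = 1\<close> and \<open>b = 0\<close>, respectively, and such a matrix
  has the eigenvalues of \<open>a I + (b + 1) N\<close> together with those of \<open>a I + (b - 1) N\<close>.
  For scalar \<open>c\<close>, the matrix \<open>c N\<close> factors through the parts as \<open>U V\<close>, where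
  \<open>V U = c m (J - I)\<close> has size \<open>k\<close>. The spectra of \<open>a I + U V\<close> and \<open>a I + V U\<close> differ only in
  the multiplicity of \<open>a\<close>, and the same fact applied to the rank-one matrix \<open>c m J\<close>
  reduces everything to a \<open>1 \<times> 1\<close> matrix.\<close>

section \<open>Small identities, and characteristic polynomials of block triangular matrices\<close>

lemma replicate_mset_add: "replicate_mset (a + b) x = replicate_mset a x + replicate_mset b x"
  by (induction a) auto

lemma uminus_zero_mat: "- 0\<^sub>m n m = (0\<^sub>m n m :: 'a :: group_add mat)"
  by (intro eq_matI) auto

lemma add_uminus_self_mat:
  "A \<in> carrier_mat n m \<Longrightarrow> A + (- A) = (0\<^sub>m n m :: 'a :: group_add mat)"
  by (intro eq_matI) auto

text \<open>Subtracting from \<open>x I\<close> keeps the zero block, so the determinant over the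
  polynomial ring splits into those of the diagonal blocks.\<close>

lemma char_poly_four_block_mat_lower_left_zero:
  fixes A :: "'a :: idom mat"
  assumes "A \<in> carrier_mat n n" "B \<in> carrier_mat n m" "D \<in> carrier_mat m m"
  shows "char_poly (four_block_mat A B (0\<^sub>m m n) D) = char_poly A * char_poly D"
proof -
  have "char_poly_matrix (four_block_mat A B (0\<^sub>m m n) D) =
      four_block_mat (char_poly_matrix A) (map_mat (\<lambda>a. [:- a:]) B) (0\<^sub>m m n) (char_poly_matrix D)"
    using assms by (intro eq_matI) (auto simp: char_poly_matrix_def)
  then show ?thesis
    unfolding char_poly_def using assms
    by (simp add: det_four_block_mat_lower_left_zero[of _ n _ m])
qed

lemma char_poly_four_block_mat_upper_right_zero:
  fixes A :: "'a :: idom mat"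
  assumes "A \<in> carrier_mat n n" "C \<in> carrier_mat m n" "D \<in> carrier_mat m m"
  shows "char_poly (four_block_mat A (0\<^sub>m n m) C D) = char_poly A * char_poly D"
proof -
  have "char_poly_matrix (four_block_mat A (0\<^sub>m n m) C D) =
      four_block_mat (char_poly_matrix A) (0\<^sub>m n m) (map_mat (\<lambda>a. [:- a:]) C) (char_poly_matrix D)"
    using assms by (intro eq_matI) (auto simp: char_poly_matrix_def)
  then show ?thesis
    unfolding char_poly_def using assms
    by (simp add: det_four_block_mat_upper_right_zero[of _ n _ m])
qed

text \<open>Supplies the nonzero factors for which the root multiset of a product is the sum of root
  multisets.\<close>

lemma char_poly_neq_0:
  fixes A :: "'a :: idom mat"
  assumes "A \<in> carrier_mat n n"
  shows "char_poly A \<noteq> 0"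
  using degree_monic_char_poly[OF assms] by auto

section \<open>Spectra as root multisets, and their behaviour under similarity\<close>

lemma spectrum_mset_upper_triangular:
  assumes "A \<in> carrier_mat n n" "upper_triangular A"
  shows "spectrum_mset A = mset (diag_mat A)"
proof -
  have "proots (\<Prod>a\<leftarrow>as. [:- a, 1:]) = mset as" for as :: "complex list"
  proof (induction as)
    case (Cons a as)
    have "(\<Prod>a\<leftarrow>as. [:- a, 1:]) \<noteq> (0 :: complex poly)"
      by (auto simp: prod_list_zero_iff)
    with Cons show ?case
      by (simp add: proots_mult del: mult_pCons_left)
  qed simp
  then show ?thesis
    unfolding spectrum_mset_def char_poly_upper_triangular[OF assms] .
qed

lemma spectrum_mset_smult_one_mat:
  "spectrum_mset (a \<cdot>\<^sub>m 1\<^sub>m n) = replicate_mset n a"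
proof -
  have "diag_mat (a \<cdot>\<^sub>m 1\<^sub>m n) = replicate n a"
    by (auto simp: diag_mat_def intro: nth_equalityI)
  then show ?thesis
    by (subst spectrum_mset_upper_triangular[of _ n]) (auto simp: mset_replicate)
qed

text \<open>A form of Sylvester's identity: the two sides are the spectra of block triangular
  matrices \<open>M\<close> and \<open>T\<close> that are conjugate under a shear. Padding with
  copies of \<open>a\<close> covers both \<open>n \<le> k\<close> and
  \<open>k \<le> n\<close>.\<close>

lemma spectrum_mset_add_mult_commute:
  assumes A: "A \<in> carrier_mat n k" and B: "B \<in> carrier_mat k n"
  shows "spectrum_mset (a \<cdot>\<^sub>m 1\<^sub>m n + A * B) + replicate_mset k a =
         spectrum_mset (a \<cdot>\<^sub>m 1\<^sub>m k + B * A) + replicate_mset n a"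
proof -
  define M where "M = four_block_mat (a \<cdot>\<^sub>m 1\<^sub>m n + A * B) (0\<^sub>m n k) B (a \<cdot>\<^sub>m 1\<^sub>m k)"
  define T where "T = four_block_mat (a \<cdot>\<^sub>m 1\<^sub>m n) (0\<^sub>m n k) B (a \<cdot>\<^sub>m 1\<^sub>m k + B * A)"
  define S where "S = four_block_mat (1\<^sub>m n) A (0\<^sub>m k n) (1\<^sub>m k)"
  define R where "R = four_block_mat (1\<^sub>m n) (- A) (0\<^sub>m k n) (1\<^sub>m k)"
  have SR: "S * R = 1\<^sub>m (n + k)" and RS: "R * S = 1\<^sub>m (n + k)"
    unfolding S_def R_def using A
    by (subst mult_four_block_mat[of _ n n _ k _ k _ _ n _ k], auto simp: uminus_zero_mat add_uminus_self_mat[of _ n k])+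
  have carr: "M \<in> carrier_mat (n + k) (n + k)" "T \<in> carrier_mat (n + k) (n + k)"
      "S \<in> carrier_mat (n + k) (n + k)" "R \<in> carrier_mat (n + k) (n + k)"
    unfolding M_def T_def S_def R_def using A B by auto
  have MS: "M * S = four_block_mat (a \<cdot>\<^sub>m 1\<^sub>m n + A * B) ((a \<cdot>\<^sub>m 1\<^sub>m n + A * B) * A) B (a \<cdot>\<^sub>m 1\<^sub>m k + B * A)"
    unfolding M_def S_def using A B
    by (subst mult_four_block_mat[of _ n n _ k _ k _ _ n _ k]) (auto simp: comm_add_mat)
  have ST: "S * T = four_block_mat (a \<cdot>\<^sub>m 1\<^sub>m n + A * B) (A * (a \<cdot>\<^sub>m 1\<^sub>m k + B * A)) B (a \<cdot>\<^sub>m 1\<^sub>m k + B * A)"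
    unfolding T_def S_def using A B
    by (subst mult_four_block_mat[of _ n n _ k _ k _ _ n _ k]) auto
  \<comment> \<open>The other three blocks of \<open>M * S\<close> and \<open>S * T\<close> already
    agree; the upper right ones agree by associativity of \<open>A * B * A\<close>.\<close>
  have "(a \<cdot>\<^sub>m 1\<^sub>m n + A * B) * A = a \<cdot>\<^sub>m A + A * B * A"
    using A B by (subst add_mult_distrib_mat[of _ n n]) (auto simp: mult_smult_assoc_mat[of _ n n])
  also have "\<dots> = A * (a \<cdot>\<^sub>m 1\<^sub>m k + B * A)"
    using A B by (subst mult_add_distrib_mat[of _ n k]) (auto simp: mult_smult_distrib[of _ n k] assoc_mult_mat[of _ n k])
  finally have "M * S = S * T"
    unfolding MS ST by simp
  then have "M = S * T * R"
    using carr SR by (metis assoc_mult_mat right_mult_one_mat)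
  then have "similar_mat M T"
    using carr SR RS by (intro similar_matI[of _ _ S R "n + k"]) auto
  then have "char_poly M = char_poly T"
    by (rule char_poly_similar)
  moreover have "char_poly M = char_poly (a \<cdot>\<^sub>m 1\<^sub>m n + A * B) * char_poly (a \<cdot>\<^sub>m 1\<^sub>m k)"
    unfolding M_def using A B by (intro char_poly_four_block_mat_upper_right_zero) auto
  moreover have "char_poly T = char_poly (a \<cdot>\<^sub>m 1\<^sub>m n) * char_poly (a \<cdot>\<^sub>m 1\<^sub>m k + B * A)"
    unfolding T_def using A B by (intro char_poly_four_block_mat_upper_right_zero) auto
  moreover have "char_poly (a \<cdot>\<^sub>m 1\<^sub>m n + A * B) \<noteq> 0" "char_poly (a \<cdot>\<^sub>m 1\<^sub>m k) \<noteq> 0"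
      "char_poly (a \<cdot>\<^sub>m 1\<^sub>m n) \<noteq> 0" "char_poly (a \<cdot>\<^sub>m 1\<^sub>m k + B * A) \<noteq> 0"
    using A B by (intro char_poly_neq_0[of _ n] char_poly_neq_0[of _ k]; auto)+
  ultimately have "spectrum_mset (a \<cdot>\<^sub>m 1\<^sub>m n + A * B) + spectrum_mset (a \<cdot>\<^sub>m 1\<^sub>m k) =
      spectrum_mset (a \<cdot>\<^sub>m 1\<^sub>m n) + spectrum_mset (a \<cdot>\<^sub>m 1\<^sub>m k + B * A)"
    unfolding spectrum_mset_def by (metis proots_mult)
  then show ?thesis
    by (simp add: spectrum_mset_smult_one_mat add.commute)
qed

text \<open>Adding the second block column to the first and then subtracting the first block row
  from the second is a conjugation that makes the matrix block upper triangular.\<close>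

lemma spectrum_mset_four_block_circulant:
  assumes A: "A \<in> carrier_mat n n" and B: "B \<in> carrier_mat n n"
  shows "spectrum_mset (four_block_mat A B B A) = spectrum_mset (A + B) + spectrum_mset (A - B)"
proof -
  define M where "M = four_block_mat A B B A"
  define T where "T = four_block_mat (A + B) B (0\<^sub>m n n) (A - B)"
  define S :: "complex mat" where "S = four_block_mat (1\<^sub>m n) (0\<^sub>m n n) (1\<^sub>m n) (1\<^sub>m n)"
  define R :: "complex mat" where "R = four_block_mat (1\<^sub>m n) (0\<^sub>m n n) (- 1\<^sub>m n) (1\<^sub>m n)"
  have SR: "S * R = 1\<^sub>m (n + n)" and RS: "R * S = 1\<^sub>m (n + n)"
    unfolding S_def R_def
    by (subst mult_four_block_mat[of _ n n _ n _ n _ _ n _ n],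
      auto simp: uminus_zero_mat add_uminus_self_mat[of _ n n] uminus_l_inv_mat[of _ n n])+
  have carr: "M \<in> carrier_mat (n + n) (n + n)" "T \<in> carrier_mat (n + n) (n + n)"
      "S \<in> carrier_mat (n + n) (n + n)" "R \<in> carrier_mat (n + n) (n + n)"
    unfolding M_def T_def S_def R_def using A B by auto
  have "B + (A - B) = A" "B + A = A + B"
    using A B by auto
  then have "M * S = S * T"
    unfolding M_def S_def T_def using A B
    by (subst (1 2) mult_four_block_mat[of _ n n _ n _ n _ _ n _ n]) auto
  then have "M = S * T * R"
    using carr SR by (metis assoc_mult_mat right_mult_one_mat)
  then have "similar_mat M T"
    using carr SR RS by (intro similar_matI[of _ _ S R "n + n"]) auto
  then have "char_poly M = char_poly T"
    by (rule char_poly_similar)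
  moreover have "char_poly T = char_poly (A + B) * char_poly (A - B)"
    unfolding T_def using A B by (intro char_poly_four_block_mat_lower_left_zero) auto
  moreover have "char_poly (A + B) \<noteq> 0" "char_poly (A - B) \<noteq> 0"
    using A B by (intro char_poly_neq_0[of _ n]; auto)+
  ultimately show ?thesis
    unfolding spectrum_mset_def M_def by (simp add: proots_mult)
qed

text \<open>With \<open>J\<close> the all-ones matrix this is \<open>(a - b) I + b J\<close>, and
  the rank-one factorisation of \<open>b J\<close> trades it for a \<open>1 \<times> 1\<close>
  matrix.\<close>

lemma spectrum_mset_diagonal_constant:
  fixes a b :: complex
  assumes "k \<ge> 1"
  shows "spectrum_mset (mat k k (\<lambda>(i, j). if i = j then a else b)) =
    {#a + b * (of_nat k - 1)#} + replicate_mset (k - 1) (a - b)"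
proof -
  define u :: "complex mat" where "u = mat k 1 (\<lambda>_. b)"
  define v :: "complex mat" where "v = mat 1 k (\<lambda>_. 1)"
  have "mat k k (\<lambda>(i, j). if i = j then a else b) = (a - b) \<cdot>\<^sub>m 1\<^sub>m k + u * v"
    by (intro eq_matI) (auto simp: u_def v_def scalar_prod_def)
  moreover have "(a - b) \<cdot>\<^sub>m 1\<^sub>m 1 + v * u = (a + b * (of_nat k - 1)) \<cdot>\<^sub>m 1\<^sub>m 1"
    by (intro eq_matI) (auto simp: u_def v_def scalar_prod_def algebra_simps)
  ultimately have "spectrum_mset (mat k k (\<lambda>(i, j). if i = j then a else b)) + {#a - b#} =
      {#a + b * (of_nat k - 1)#} + replicate_mset k (a - b)"
    using spectrum_mset_add_mult_commute[of u k 1 v "a - b"]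
      spectrum_mset_smult_one_mat[of "a + b * (of_nat k - 1)" 1]
    by (simp add: u_def v_def)
  \<comment> \<open>One copy of \<open>a - b\<close> is cancelled from both sides, which is where
    \<open>k \<ge> 1\<close> enters.\<close>
  with assms show ?thesis
    by (cases k) auto
qed

section \<open>Equipartitions and the matrix of a complete multipartite graph\<close>

lemma equipartition_card:
  assumes "equipartition k m V P" "finite V"
  shows "card V = m * k"
proof -
  have "V = \<Union> P" "disjoint P"
    using assms(1) by (auto simp: equipartition_def partition_on_def)
  then have "card V = (\<Sum>X\<in>P. card X)"
    using assms(2) by (auto intro!: card_Union_disjoint intro: finite_subset)
  with assms show ?thesis
    by (simp add: equipartition_def)
qed

text \<open>The vertices removed form the single part containing \<open>v\<close>, by disjointness.
  The count feeds the degree computations for both graphs.\<close>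

lemma equipartition_card_not_same_part:
  assumes "equipartition k m V P" "finite V" "v \<in> V"
  shows "card {w \<in> V. \<not> same_part P v w} = m * k - m"
proof -
  from assms obtain X where X: "X \<in> P" "v \<in> X"
    unfolding equipartition_def partition_on_def by auto
  have "{w \<in> V. \<not> same_part P v w} = V - X"
    using assms X unfolding equipartition_def partition_on_def same_part_def disjoint_def by blast
  moreover have "X \<subseteq> V" "card X = m"
    using assms X unfolding equipartition_def partition_on_def by auto
  ultimately show ?thesis
    using assms by (simp add: card_Diff_subset finite_subset equipartition_card)
qed

text \<open>Factoring through the \<open>k\<close> parts leaves a \<open>k \<times> k\<close> matrix
  with diagonal \<open>a\<close> and constant off-diagonal entry \<open>c m\<close>. The scalar
  \<open>c\<close> is free because the values 2, 1, 0 and -1 all occur later.\<close>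

lemma spectrum_mset_complete_multipartite:
  fixes a c :: complex
  assumes P: "equipartition k m (set vs) P" and vs: "distinct vs" and k: "k \<ge> 1" and m: "m \<ge> 1"
  shows "spectrum_mset (mat (length vs) (length vs) (\<lambda>(i, j).
      (if i = j then a else 0) + (if same_part P (vs ! i) (vs ! j) then 0 else c))) =
    {#a + c * of_nat m * (of_nat k - 1)#} + replicate_mset (k - 1) (a - c * of_nat m) +
    replicate_mset (m * k - k) a"
proof -
  define n where "n = length vs"
  have n: "n = m * k"
    using equipartition_card[OF P] vs by (simp add: n_def distinct_card)
  have finP: "finite P"
    using P k by (auto simp: equipartition_def intro: card_ge_0_finite)
  then obtain ps where ps: "distinct ps" "set ps = P"
    using finite_distinct_list by blast
  then have lps: "length ps = k"
    using P by (auto simp: equipartition_def distinct_card[symmetric])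
  have part: "ps ! j \<in> P" "card (ps ! j) = m" "ps ! j \<subseteq> set vs" if "j < k" for j
    using that ps lps P by (auto simp: equipartition_def partition_on_def)
  have disj: "x \<notin> ps ! j" if "x \<in> ps ! i" "i < k" "j < k" "i \<noteq> j" for x i j
  proof -
    have "ps ! i \<noteq> ps ! j"
      using that ps lps by (simp add: nth_eq_iff_index_eq)
    then have "ps ! i \<inter> ps ! j = {}"
      using part(1) that P unfolding equipartition_def partition_on_def
      by (metis disjointD)
    with that show ?thesis by blast
  qed
  \<comment> \<open>\<open>U\<close> is the incidence matrix of vertices and parts; \<open>V\<close>
    is \<open>c\<close> times the complement of its transpose.\<close>
  define U where "U = mat n k (\<lambda>(i, j). if vs ! i \<in> ps ! j then 1 else 0 :: complex)"
  define V where "V = mat k n (\<lambda>(j, i). if vs ! i \<in> ps ! j then 0 else c)"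
  have UV: "(U * V) $$ (i, i') = (if same_part P (vs ! i) (vs ! i') then 0 else c)"
    if i: "i < n" "i' < n" for i i'
  proof -
    have "vs ! i \<in> \<Union> P"
      using i P by (auto simp: n_def equipartition_def partition_on_def)
    then obtain j where j: "j < k" "vs ! i \<in> ps ! j"
      using ps lps by (metis UnionE in_set_conv_nth)
    have "(U * V) $$ (i, i') =
        (\<Sum>l<k. (if vs ! i \<in> ps ! l then 1 else 0) * (if vs ! i' \<in> ps ! l then 0 else c))"
      using i by (auto simp: U_def V_def scalar_prod_def atLeast0LessThan)
    \<comment> \<open>Each vertex lies in one part only, so a single term survives.\<close>
    also have "\<dots> = (\<Sum>l<k. if l = j then (if vs ! i' \<in> ps ! j then 0 else c) else 0)"
      using j disj by (intro sum.cong) auto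
    also have "\<dots> = (if vs ! i' \<in> ps ! j then 0 else c)"
      using j by simp
    also have "vs ! i' \<in> ps ! j \<longleftrightarrow> same_part P (vs ! i) (vs ! i')"
    proof
      assume "same_part P (vs ! i) (vs ! i')"
      then obtain l where "l < k" "vs ! i \<in> ps ! l" "vs ! i' \<in> ps ! l"
        using ps lps unfolding same_part_def by (metis in_set_conv_nth)
      then show "vs ! i' \<in> ps ! j"
        using disj j by metis
    qed (use part j in \<open>auto simp: same_part_def\<close>)
    finally show ?thesis .
  qed
  have VU: "(V * U) $$ (j, l) = (if j = l then 0 else c * of_nat m)" if j: "j < k" "l < k" for j l
  proof -
    have "(V * U) $$ (j, l) =
        (\<Sum>i<n. (if vs ! i \<in> ps ! j then 0 else c) * (if vs ! i \<in> ps ! l then 1 else 0))"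
      using j by (auto simp: U_def V_def scalar_prod_def atLeast0LessThan)
    \<comment> \<open>Passing from positions to vertices prepares for restricting the sum to the
      part \<open>ps ! l\<close>, whose size is known.\<close>
    also have "\<dots> = (\<Sum>x\<in>set vs. (if x \<in> ps ! j then 0 else c) * (if x \<in> ps ! l then 1 else 0))"
      using bij_betw_nth[OF vs refl refl] unfolding n_def
      by (rule sum.reindex_bij_betw)
    also have "\<dots> = (\<Sum>x\<in>ps ! l. if x \<in> ps ! j then 0 else c)"
      using part(3)[of l] j by (intro sum.mono_neutral_cong_right) auto
    also have "\<dots> = (\<Sum>x\<in>ps ! l. if j = l then 0 else c)"
      using j disj by (intro sum.cong) auto
    finally show ?thesis
      using part(2)[of l] j by simp
  qed
  have "mat n n (\<lambda>(i, j).
      (if i = j then a else 0) + (if same_part P (vs ! i) (vs ! j) then 0 else c)) =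
      a \<cdot>\<^sub>m 1\<^sub>m n + U * V"
    using UV by (intro eq_matI) (auto simp: U_def V_def)
  moreover have "a \<cdot>\<^sub>m 1\<^sub>m k + V * U = mat k k (\<lambda>(i, j). if i = j then a else c * of_nat m)"
    using VU by (intro eq_matI) (auto simp: U_def V_def)
  moreover have "U \<in> carrier_mat n k" "V \<in> carrier_mat k n"
    by (auto simp: U_def V_def)
  \<comment> \<open>The subtraction of naturals is exact: \<open>m \<ge> 1\<close> gives
    \<open>k \<le> m * k\<close>.\<close>
  moreover have "replicate_mset n a = replicate_mset (m * k - k) a + replicate_mset k a"
    using m n by (simp flip: replicate_mset_add)
  ultimately show ?thesis
    using spectrum_mset_add_mult_commute[of U n k V a] spectrum_mset_diagonal_constant[OF k]
    unfolding n_def[symmetric] by (simp add: add.assoc)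
qed

section \<open>Degrees as cardinalities\<close>

text \<open>Multiplicities 0 and 1 make the filtered multiset a set, which \<open>Pair v\<close>
  parametrises injectively.\<close>

lemma out_deg_eq_card:
  assumes "mixed_graph G" "v \<in> verts G"
    and "\<And>u w. u \<in> verts G \<Longrightarrow> w \<in> verts G \<Longrightarrow> count (arcs G) (u, w) = (if R u w then 0 else 1)"
  shows "out_deg G v = card {w \<in> verts G. \<not> R v w}"
proof -
  have fin: "finite (verts G)" using assms by (simp add: mixed_graph_def)
  have "{# a \<in># arcs G. fst a = v #} = mset_set (Pair v ` {w \<in> verts G. \<not> R v w})"
  proof (rule multiset_eqI)
    fix a
    \<comment> \<open>The counting hypothesis covers only pairs of vertices;
      \<open>mixed_graph G\<close> settles all other pairs.\<close>
    have "count (arcs G) a = 0" if "fst a \<notin> verts G \<or> snd a \<notin> verts G"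
      using that assms(1) by (auto simp: mixed_graph_def not_in_iff[symmetric])
    then show "count {# a \<in># arcs G. fst a = v #} a =
        count (mset_set (Pair v ` {w \<in> verts G. \<not> R v w})) a"
      using assms(2,3) fin
      by (cases a; cases "fst a \<in> verts G \<and> snd a \<in> verts G") (auto simp: count_mset_set' image_iff)
  qed
  then show ?thesis
    by (simp add: out_deg_def card_image inj_on_def)
qed

lemma in_deg_eq_card:
  assumes "mixed_graph G" "v \<in> verts G"
    and "\<And>u w. u \<in> verts G \<Longrightarrow> w \<in> verts G \<Longrightarrow> count (arcs G) (u, w) = (if R u w then 0 else 1)"
  shows "in_deg G v = card {u \<in> verts G. \<not> R u v}"
proof -
  have fin: "finite (verts G)" using assms by (simp add: mixed_graph_def)
  have "{# a \<in># arcs G. snd a = v #} = mset_set ((\<lambda>u. (u, v)) ` {u \<in> verts G. \<not> R u v})"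
  proof (rule multiset_eqI)
    fix a
    have "count (arcs G) a = 0" if "fst a \<notin> verts G \<or> snd a \<notin> verts G"
      using that assms(1) by (auto simp: mixed_graph_def not_in_iff[symmetric])
    then show "count {# a \<in># arcs G. snd a = v #} a =
        count (mset_set ((\<lambda>u. (u, v)) ` {u \<in> verts G. \<not> R u v})) a"
      using assms(2,3) fin
      by (cases a; cases "fst a \<in> verts G \<and> snd a \<in> verts G") (auto simp: count_mset_set' image_iff)
  qed
  then show ?thesis
    by (simp add: in_deg_def card_image inj_on_def)
qed

text \<open>An edge at \<open>v\<close> is \<open>Upair v w\<close> for a unique \<open>w\<close>,
  so edges at \<open>v\<close> are counted by their other end.\<close>

lemma deg_eq_card:
  assumes "mixed_graph G" "v \<in> verts G"
    and "\<And>u w. u \<in> verts G \<Longrightarrow> w \<in> verts G \<Longrightarrow>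
      count (edges G) (Upair u w) = (if R u w then 0 else 1)"
  shows "deg G v = card {w \<in> verts G. \<not> R v w}"
proof -
  have fin: "finite (verts G)" using assms by (simp add: mixed_graph_def)
  have "{# e \<in># edges G. v \<in> set_uprod e #} = mset_set (Upair v ` {w \<in> verts G. \<not> R v w})"
  proof (rule multiset_eqI)
    fix e
    show "count {# e \<in># edges G. v \<in> set_uprod e #} e =
        count (mset_set (Upair v ` {w \<in> verts G. \<not> R v w})) e"
    proof (cases "v \<in> set_uprod e")
      case True
      then obtain w where e: "e = Upair v w"
        by (cases e) (auto intro: that)
      have "count (edges G) e = 0" if "w \<notin> verts G"
        using that assms(1) e by (auto simp: mixed_graph_def not_in_iff[symmetric])
      then show ?thesis
        using assms(2,3) fin e by (cases "w \<in> verts G") (auto simp: count_mset_set' image_iff)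
    next
      case False
      then have "e \<notin> Upair v ` {w \<in> verts G. \<not> R v w}" by auto
      with False fin show ?thesis by (simp add: count_mset_set')
    qed
  qed
  moreover have "inj_on (Upair v) {w \<in> verts G. \<not> R v w}"
    by (auto simp: inj_on_def)
  ultimately show ?thesis
    by (simp add: deg_def card_image)
qed

section \<open>A common spectrum formula for both graphs\<close>

text \<open>The edge multiplicity \<open>b\<close> is 1 for \<open>is_KM\<close> and 0 for
  \<open>is_KD\<close>, and \<open>d\<close> is the constant entry of the degree matrix. The first
  three summands come from the sum of the two blocks, the last three from their difference.\<close>

lemma spectrum_mset_integrated_signless_laplacian:
  fixes G :: "'a mixed_graph" and b d :: nat
  assumes P: "equipartition k m (verts G) P" and vs: "vertex_ordering G vs"
    and k: "k \<ge> 1" and m: "m \<ge> 1"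
    and edges: "\<And>u w. u \<in> verts G \<Longrightarrow> w \<in> verts G \<Longrightarrow>
      count (edges G) (Upair u w) = (if same_part P u w then 0 else b)"
    and arcs: "\<And>u w. u \<in> verts G \<Longrightarrow> w \<in> verts G \<Longrightarrow>
      count (arcs G) (u, w) = (if same_part P u w then 0 else 1)"
    and deg: "\<And>v. v \<in> verts G \<Longrightarrow> deg G v + out_deg G v = d"
      "\<And>v. v \<in> verts G \<Longrightarrow> deg G v + in_deg G v = d"
  shows "spectrum_mset (integrated_signless_laplacian G vs) =
      {#of_nat d + (of_nat b + 1) * of_nat m * (of_nat k - 1)#} +
      replicate_mset (k - 1) (of_nat d - (of_nat b + 1) * of_nat m) +
      replicate_mset (m * k - k) (of_nat d) +
      ({#of_nat d + (of_nat b - 1) * of_nat m * (of_nat k - 1)#} +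
      replicate_mset (k - 1) (of_nat d - (of_nat b - 1) * of_nat m) +
      replicate_mset (m * k - k) (of_nat d))"
proof -
  define n where "n = length vs"
  have dist: "distinct vs" and set: "set vs = verts G"
    using vs by (auto simp: vertex_ordering_def)
  \<comment> \<open>The family is linear in \<open>(a, c)\<close>, so sums and differences of blocks
    stay inside it.\<close>
  define N where "N a c = mat n n (\<lambda>(i, j).
    (if i = j then a else 0) + (if same_part P (vs ! i) (vs ! j) then 0 else c))" for a c :: complex
  have V: "vs ! i \<in> verts G" if "i < n" for i
    using that set nth_mem unfolding n_def by blast
  have sym: "same_part P u w \<longleftrightarrow> same_part P w u" for u w
    by (auto simp: same_part_def)
  \<comment> \<open>Symmetry of \<open>same_part\<close> makes the arc matrix its own transpose, and
    the equal degree sums make the diagonal blocks coincide.\<close>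
  have "integrated_signless_laplacian G vs =
      four_block_mat (N (of_nat d) (of_nat b)) (N 0 1) (N 0 1) (N (of_nat d) (of_nat b))"
    unfolding integrated_signless_laplacian_def integrated_degree_def integrated_adjacency_def
      edge_matrix_def arc_matrix_def N_def n_def[symmetric]
    using V deg[OF V] edges[OF V V] arcs[OF V V]
    by (intro eq_matI) (auto simp: mat_diag_def sym simp flip: of_nat_add)
  also have "spectrum_mset \<dots> = spectrum_mset (N (of_nat d) (of_nat b) + N 0 1) +
      spectrum_mset (N (of_nat d) (of_nat b) - N 0 1)"
    by (rule spectrum_mset_four_block_circulant) (auto simp: N_def)
  also have "N (of_nat d) (of_nat b) + N 0 1 = N (of_nat d) (of_nat b + 1)"
    by (auto simp: N_def)
  also have "N (of_nat d) (of_nat b) - N 0 1 = N (of_nat d) (of_nat b - 1)"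
    by (auto simp: N_def)
  finally show ?thesis
    using P dist k m unfolding N_def n_def set[symmetric]
    by (simp only: spectrum_mset_complete_multipartite)
qed

section \<open>The two spectra\<close>

theorem theorem4p6:
  fixes k m :: nat
  assumes "k \<ge> 1" and "m \<ge> 1"
  shows "(\<forall>(G :: 'a mixed_graph) vs. is_KM k m G \<and> vertex_ordering G vs \<longrightarrow>
            spectrum_mset (integrated_signless_laplacian G vs) =
              replicate_mset 1 (4 * of_nat m * of_nat k - 4 * of_nat m)
            + replicate_mset (k - 1) (2 * of_nat m * of_nat k - 4 * of_nat m)
            + replicate_mset (2 * m * k - k) (2 * of_nat m * of_nat k - 2 * of_nat m))
       \<and> (\<forall>(G :: 'a mixed_graph) vs. is_KD k m G \<and> vertex_ordering G vs \<longrightarrow>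
            spectrum_mset (integrated_signless_laplacian G vs) =
              replicate_mset 1 (2 * of_nat m * of_nat k - 2 * of_nat m)
            + replicate_mset 1 0
            + replicate_mset (k - 1) (of_nat m * of_nat k)
            + replicate_mset (k - 1) (of_nat m * of_nat k - 2 * of_nat m)
            + replicate_mset (2 * k * m - 2 * k) (of_nat m * of_nat k - of_nat m))"
proof (intro conjI allI impI; elim conjE)
  \<comment> \<open>These bounds make the later subtractions of naturals exact.\<close>
  have mk: "m \<le> m * k" "k \<le> m * k"
    using assms by auto
  have sym: "same_part P u w \<longleftrightarrow> same_part P w u" for P and u w :: 'a
    by (auto simp: same_part_def)
  fix G :: "'a mixed_graph" and vs
  assume vs: "vertex_ordering G vs"
  {
    assume "is_KM k m G"
    then obtain P where G: "mixed_graph G" and P: "equipartition k m (verts G) P"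
      and edges: "\<And>u v. u \<in> verts G \<Longrightarrow> v \<in> verts G \<Longrightarrow>
        count (edges G) (Upair u v) = (if same_part P u v then 0 else 1)"
      and arcs: "\<And>u v. u \<in> verts G \<Longrightarrow> v \<in> verts G \<Longrightarrow>
        count (arcs G) (u, v) = (if same_part P u v then 0 else 1)"
      unfolding is_KM_def by blast
    have fin: "finite (verts G)" using G by (simp add: mixed_graph_def)
    note card = equipartition_card_not_same_part[OF P fin]
    have deg: "deg G v + out_deg G v = 2 * (m * k - m)" "deg G v + in_deg G v = 2 * (m * k - m)"
      if "v \<in> verts G" for v
      using deg_eq_card[OF G that edges] out_deg_eq_card[OF G that arcs]
        in_deg_eq_card[OF G that arcs] card[OF that] by (simp_all add: sym)
    have 1: "of_nat (2 * (m * k - m)) = (2 * of_nat m * of_nat k - 2 * of_nat m :: complex)"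
      using mk by (simp add: of_nat_diff algebra_simps)
    \<comment> \<open>For \<open>b = 1\<close> the difference of the blocks is \<open>d I\<close>,
      so all three of its summands, of sizes \<open>1\<close>, \<open>k - 1\<close> and
      \<open>m * k - k\<close>, consist of copies of \<open>d\<close>.\<close>
    have "2 * m * k - k = (m * k - k) + (1 + (k - 1) + (m * k - k))"
      using mk assms by simp
    then have 2: "replicate_mset (2 * m * k - k) x = replicate_mset (m * k - k) x +
        ({#x#} + replicate_mset (k - 1) x + replicate_mset (m * k - k) x)" for x :: complex
      by (simp only: replicate_mset_add) simp
    show "spectrum_mset (integrated_signless_laplacian G vs) =
        replicate_mset 1 (4 * of_nat m * of_nat k - 4 * of_nat m)
      + replicate_mset (k - 1) (2 * of_nat m * of_nat k - 4 * of_nat m)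
      + replicate_mset (2 * m * k - k) (2 * of_nat m * of_nat k - 2 * of_nat m)"
      using spectrum_mset_integrated_signless_laplacian[OF P vs assms edges arcs deg]
      unfolding 1 2 by (simp add: algebra_simps)
  }
  {
    assume "is_KD k m G"
    then obtain P where G: "mixed_graph G" and P: "equipartition k m (verts G) P"
      and no_edges: "edges G = {#}"
      and arcs: "\<And>u v. u \<in> verts G \<Longrightarrow> v \<in> verts G \<Longrightarrow>
        count (arcs G) (u, v) = (if same_part P u v then 0 else 1)"
      unfolding is_KD_def by blast
    have fin: "finite (verts G)" using G by (simp add: mixed_graph_def)
    note card = equipartition_card_not_same_part[OF P fin]
    have deg: "deg G v + out_deg G v = m * k - m" "deg G v + in_deg G v = m * k - m"
      if "v \<in> verts G" for v
      using out_deg_eq_card[OF G that arcs] in_deg_eq_card[OF G that arcs] card[OF that]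
      by (simp_all add: sym deg_def no_edges)
    \<comment> \<open>Both branches are 0 to match the general formula at
      \<open>b = 0\<close>.\<close>
    have edges: "count (edges G) (Upair u v) = (if same_part P u v then 0 else 0)" for u v
      by (simp add: no_edges)
    have 1: "of_nat (m * k - m) = (of_nat m * of_nat k - of_nat m :: complex)"
      using mk by (simp add: of_nat_diff)
    \<comment> \<open>Each half contributes \<open>m * k - k\<close> copies of \<open>d\<close>. The
      difference half, with coefficient \<open>b - 1 = -1\<close>, also yields the eigenvalues
      \<open>0\<close> and \<open>m k\<close>.\<close>
    have "2 * k * m - 2 * k = (m * k - k) + (m * k - k)"
      using mk by (simp add: algebra_simps)
    then have 2: "replicate_mset (2 * k * m - 2 * k) x =
        replicate_mset (m * k - k) x + replicate_mset (m * k - k) x" for x :: complex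
      by (simp only: replicate_mset_add)
    show "spectrum_mset (integrated_signless_laplacian G vs) =
        replicate_mset 1 (2 * of_nat m * of_nat k - 2 * of_nat m)
      + replicate_mset 1 0
      + replicate_mset (k - 1) (of_nat m * of_nat k)
      + replicate_mset (k - 1) (of_nat m * of_nat k - 2 * of_nat m)
      + replicate_mset (2 * k * m - 2 * k) (of_nat m * of_nat k - of_nat m)"
      using spectrum_mset_integrated_signless_laplacian[OF P vs assms edges arcs deg]
      unfolding 1 2 by (simp add: algebra_simps)
  }
qed

end
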